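(* Let $A$ be a commutative ring, $I$ a set, $G$ a commutative group, $\psi\colon\mathbb{Z}^{\oplus I}\twoheadrightarrow G$ an epimorphism of groups, and let $R=A[(X_i)_{i\in I}]$ be the polynomial algebra, furnished with the $G$-graduation derived from its canonical $\mathbb{Z}^{\oplus I}$-graduation by means of $\psi$. Let $H\subseteq G$ be a subgroup of finite index, and let $S=R_{(H)}$ be the degree restriction of $R$ to $H$. For every monomial ideal $\mathfrak{a}\subseteq R$ of finite type we have $$\Gamma_{\mathfrak{a}_{(H)}}=\Gamma_{\lfloor\mathfrak{a}\rfloor_H}=\Gamma_{\lfloor\mathfrak{a}\rfloor_{(H)}}$$ as torsion functors on the category of $H$-graded $S$-modules.
   Context: Rings are commutative with unit and $\mathbb{N}$ contains $0$. A monomial in $R$ is an element of the form $\prod_{i\in I}X_i^{\mu_i}$ with $\mu=(\mu_i)_{i\in I}\in\mathbb{N}^{\oplus I}$; it is homogeneous of degree $\psi(\mu)\in G$. A monomial ideal of $R$ is an ideal of $R$ generated by a set of monomials. "Of finite type" means finitely generated. The degree restriction $S=R_{(H)}$ is the sub-$A$-algebra of $R$ generated by the monomials $\prod_{i\in I}X_i^{\mu_i}$ with $\psi(\mu)\in H$, i.e. $S=\bigoplus_{h\in H}R_h$, furnished with the $H$-graduation with $\deg(\prod_{i\in I}X_i^{\mu_i})=\psi(\mu)$. For a monomial ideal $\mathfrak{a}\subseteq R$ there is a unique subset $E(\mathfrak{a})\subseteq\mathbb{N}^{\oplus I}$ such that $\{\prod_{i\in I}X_i^{\mu_i}\mid\mu\in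 E(\mathfrak{a})\}$ is a minimal generating set of $\mathfrak{a}$, and one defines the monomial ideal $\lfloor\mathfrak{a}\rfloor:=\langle\prod_{i\in I,\,\mu_i>0}X_i\mid\mu\in E(\mathfrak{a})\rangle_R$ of $R$. For a monomial ideal $\mathfrak{c}\subseteq R$ put $\mathfrak{c}_{(H)}:=\mathfrak{c}\cap S$, a graded ideal of $S$; in particular $\lfloor\mathfrak{a}\rfloor_{(H)}=\lfloor\mathfrak{a}\rfloor\cap S$. Since $H$ has finite index in $G$, for $\mu\in E(\mathfrak{a})$ there is a minimal $m\in\mathbb{N}$ with $\prod_{i\in I,\,\mu_i>0}X_i^m\in\mathfrak{a}_{(H)}$, denoted by $m_\mu$; one defines $\lfloor\mathfrak{a}\rfloor_H:=\langle\prod_{i\in I,\,\mu_i>0}X_i^{m_\mu}\mid\mu\in E(\mathfrak{a})\rangle_S\subseteq S$ (ideal of $S$ generated by these elements). For a graded ideal $\mathfrak{c}\subseteq S$, $\Gamma_{\mathfrak{c}}$ denotes the $H$-graded $\mathfrak{c}$-torsion functor, i.e. the subfunctor of the identity functor on the category of $H$-graded $S$-modules with $\Gamma_{\mathfrak{c}}(M)=\bigcup_{n\in\mathbb{N}}(0:_M\mathfrak{c}^n)$. Equality of such functors is equality as subfunctors of the identity, i.e. equality of the submodules for every $H$-graded $S$-module $M$. *)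

theory Defs
  imports "HOL-Algebra.Algebra" "HOL-Library.Poly_Mapping"
begin

text \<open>
  The coefficient ring \<open>A\<close> is a type of sort \<open>{comm_ring, comm_monoid_mult}\<close>: a commutative
  ring with unit for which, in contrast to \<open>comm_ring_1\<close>, \<open>0 = 1\<close> is not excluded. The index set
  \<open>I\<close> is an arbitrary, possibly empty, set. As \<open>1\<close> on \<open>poly_mapping\<close> requires \<open>0 \<noteq> 1\<close>, the unit
  of the polynomial algebra is written as the monomial with exponent \<open>0\<close>.
\<close>

definition exps :: "'i set \<Rightarrow> ('i \<Rightarrow>\<^sub>0 nat) set" where
  "exps I = {\<mu>. Poly_Mapping.keys \<mu> \<subseteq> I}"

definition monomial :: "('i \<Rightarrow>\<^sub>0 nat) \<Rightarrow> ('i \<Rightarrow>\<^sub>0 nat) \<Rightarrow>\<^sub>0 'a::{comm_ring, comm_monoid_mult}" where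
  "monomial \<mu> = Poly_Mapping.single \<mu> 1"

definition poly_alg :: "'i set \<Rightarrow> (('i \<Rightarrow>\<^sub>0 nat) \<Rightarrow>\<^sub>0 'a::{comm_ring, comm_monoid_mult}) ring" where
  "poly_alg I = \<lparr>carrier = {f. Poly_Mapping.keys f \<subseteq> exps I}, monoid.mult = (*), one = monomial 0,
                 ring.zero = 0, ring.add = (+)\<rparr>"

text \<open>The degree \<open>\<psi>(\<mu>)\<close> of the monomial with exponent \<open>\<mu>\<close>.\<close>

definition mdeg :: "(('i \<Rightarrow>\<^sub>0 int) \<Rightarrow> 'g) \<Rightarrow> ('i \<Rightarrow>\<^sub>0 nat) \<Rightarrow> 'g" where
  "mdeg \<psi> \<mu> = \<psi> (Poly_Mapping.map int \<mu>)"

definition homog :: "'i set \<Rightarrow> (('i \<Rightarrow>\<^sub>0 int) \<Rightarrow> 'g) \<Rightarrow> 'g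
    \<Rightarrow> (('i \<Rightarrow>\<^sub>0 nat) \<Rightarrow>\<^sub>0 'a::{comm_ring, comm_monoid_mult}) set" where
  "homog I \<psi> g = {f \<in> carrier (poly_alg I). \<forall>\<mu> \<in> Poly_Mapping.keys f. mdeg \<psi> \<mu> = g}"

definition deg_restr :: "'i set \<Rightarrow> (('i \<Rightarrow>\<^sub>0 int) \<Rightarrow> 'g) \<Rightarrow> 'g set
    \<Rightarrow> (('i \<Rightarrow>\<^sub>0 nat) \<Rightarrow>\<^sub>0 'a::{comm_ring, comm_monoid_mult}) ring" where
  "deg_restr I \<psi> H = (poly_alg I)
     \<lparr>carrier := {f \<in> carrier (poly_alg I). \<forall>\<mu> \<in> Poly_Mapping.keys f. mdeg \<psi> \<mu> \<in> H}\<rparr>"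

definition finite_type :: "('r, 'x) ring_scheme \<Rightarrow> 'r set \<Rightarrow> bool" where
  "finite_type R \<aa> \<longleftrightarrow> (\<exists>F. finite F \<and> F \<subseteq> carrier R \<and> \<aa> = Idl\<^bsub>R\<^esub> F)"

definition monomial_ideal :: "'i set \<Rightarrow> (('i \<Rightarrow>\<^sub>0 nat) \<Rightarrow>\<^sub>0 'a::{comm_ring, comm_monoid_mult}) set
    \<Rightarrow> bool" where
  "monomial_ideal I \<aa> \<longleftrightarrow> (\<exists>M \<subseteq> exps I. \<aa> = Idl\<^bsub>poly_alg I\<^esub> (monomial ` M))"

text \<open>
  The set \<open>E(\<aa>)\<close>. Minimality refers to the set of monomials, not to the set of exponents. Over the
  zero ring all monomials coincide, and \<open>E(\<aa>)\<close> is empty.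
\<close>

definition min_exps :: "'i set \<Rightarrow> (('i \<Rightarrow>\<^sub>0 nat) \<Rightarrow>\<^sub>0 'a::{comm_ring, comm_monoid_mult}) set
    \<Rightarrow> ('i \<Rightarrow>\<^sub>0 nat) set" where
  "min_exps I \<aa> = (THE E. E \<subseteq> exps I \<and> Idl\<^bsub>poly_alg I\<^esub> (monomial ` E) = \<aa> \<and>
     (\<forall>B. B \<subset> monomial ` E \<longrightarrow> Idl\<^bsub>poly_alg I\<^esub> B \<noteq> \<aa>))"

text \<open>The product of the \<open>m\<close>-th powers of those \<open>X\<^sub>i\<close> with \<open>\<mu>\<^sub>i > 0\<close>
  (\<open>Poly_Mapping.map\<close> leaves zero values unchanged).\<close>

definition supp_mono :: "nat \<Rightarrow> ('i \<Rightarrow>\<^sub>0 nat)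
    \<Rightarrow> ('i \<Rightarrow>\<^sub>0 nat) \<Rightarrow>\<^sub>0 'a::{comm_ring, comm_monoid_mult}" where
  "supp_mono m \<mu> = monomial (Poly_Mapping.map (\<lambda>_. m) \<mu>)"

definition floor_ideal :: "'i set \<Rightarrow> (('i \<Rightarrow>\<^sub>0 nat) \<Rightarrow>\<^sub>0 'a::{comm_ring, comm_monoid_mult}) set
    \<Rightarrow> (('i \<Rightarrow>\<^sub>0 nat) \<Rightarrow>\<^sub>0 'a) set" where
  "floor_ideal I \<aa> = Idl\<^bsub>poly_alg I\<^esub> (supp_mono 1 ` min_exps I \<aa>)"

definition restr_ideal :: "'i set \<Rightarrow> (('i \<Rightarrow>\<^sub>0 int) \<Rightarrow> 'g) \<Rightarrow> 'g set
    \<Rightarrow> (('i \<Rightarrow>\<^sub>0 nat) \<Rightarrow>\<^sub>0 'a::{comm_ring, comm_monoid_mult}) set \<Rightarrow> (('i \<Rightarrow>\<^sub>0 nat) \<Rightarrow>\<^sub>0 'a) set" where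
  "restr_ideal I \<psi> H \<cc> = \<cc> \<inter> carrier (deg_restr I \<psi> H)"

definition floor_restr_ideal :: "'i set \<Rightarrow> (('i \<Rightarrow>\<^sub>0 int) \<Rightarrow> 'g) \<Rightarrow> 'g set
    \<Rightarrow> (('i \<Rightarrow>\<^sub>0 nat) \<Rightarrow>\<^sub>0 'a::{comm_ring, comm_monoid_mult}) set \<Rightarrow> (('i \<Rightarrow>\<^sub>0 nat) \<Rightarrow>\<^sub>0 'a) set" where
  "floor_restr_ideal I \<psi> H \<aa> = Idl\<^bsub>deg_restr I \<psi> H\<^esub>
     ((\<lambda>\<mu>. supp_mono (LEAST m. supp_mono m \<mu> \<in> restr_ideal I \<psi> H \<aa>) \<mu>) ` min_exps I \<aa>)"

text \<open>
  \<open>M\<close> is a module over the ring \<open>S\<close>, graded by the group \<open>K\<close> with homogeneous components \<open>N\<close>, where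
  \<open>S\<^sub>g = sgr g\<close> are the homogeneous components of \<open>S\<close>.
\<close>

definition graded_module :: "('g, 'w) monoid_scheme \<Rightarrow> ('s, 'x) ring_scheme \<Rightarrow> ('g \<Rightarrow> 's set)
    \<Rightarrow> ('s, 'm, 'y) module_scheme \<Rightarrow> ('g \<Rightarrow> 'm set) \<Rightarrow> bool" where
  "graded_module K S sgr M N \<longleftrightarrow>
     Module.module S M \<and>
     (\<forall>g \<in> carrier K. additive_subgroup (N g) M) \<and>
     (\<forall>x \<in> carrier M. \<exists>!c. c \<in> (\<Pi>\<^sub>E g \<in> carrier K. N g) \<and>
        finite {g \<in> carrier K. c g \<noteq> \<zero>\<^bsub>M\<^esub>} \<and>
        x = (\<Oplus>\<^bsub>M\<^esub> g \<in> {g \<in> carrier K. c g \<noteq> \<zero>\<^bsub>M\<^esub>}. c g)) \<and>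
     (\<forall>g \<in> carrier K. \<forall>h \<in> carrier K. \<forall>s \<in> sgr g. \<forall>x \<in> N h. s \<odot>\<^bsub>M\<^esub> x \<in> N (g \<otimes>\<^bsub>K\<^esub> h))"

text \<open>Powers of ideals are taken in the monoid \<open>ideals_set S\<close>, whose unit is \<open>carrier S\<close>.\<close>

definition torsion :: "('s, 'x) ring_scheme \<Rightarrow> 's set \<Rightarrow> ('s, 'm, 'y) module_scheme \<Rightarrow> 'm set" where
  "torsion S \<cc> M =
     (\<Union>n::nat. {x \<in> carrier M. \<forall>s \<in> \<cc> [^]\<^bsub>ideals_set S\<^esub> n. s \<odot>\<^bsub>M\<^esub> x = \<zero>\<^bsub>M\<^esub>})"

lemma lookup_map_int: "Poly_Mapping.lookup (Poly_Mapping.map int \<mu>) i = int (Poly_Mapping.lookup \<mu> i)"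
  by (simp add: Poly_Mapping.map.rep_eq when_def)

lemma map_int_zero: "Poly_Mapping.map int 0 = 0"
  by (rule poly_mapping_eqI) (simp add: lookup_map_int)

lemma map_int_add: "Poly_Mapping.map int (\<mu> + \<nu>) = Poly_Mapping.map int \<mu> + Poly_Mapping.map int \<nu>"
  by (rule poly_mapping_eqI) (simp add: lookup_map_int lookup_add)

lemma keys_map_int: "Poly_Mapping.keys (Poly_Mapping.map int \<mu>) = Poly_Mapping.keys \<mu>"
  by (simp add: set_eq_iff in_keys_iff lookup_map_int)

lemma exps_zero: "0 \<in> exps I"
  by (simp add: exps_def)

lemma exps_add: "\<mu> \<in> exps I \<Longrightarrow> \<nu> \<in> exps I \<Longrightarrow> \<mu> + \<nu> \<in> exps I"
  unfolding exps_def using keys_add[of \<mu> \<nu>] by blast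

lemma keys_neg: "Poly_Mapping.keys (- f) = Poly_Mapping.keys (f :: 'b \<Rightarrow>\<^sub>0 'a::ab_group_add)"
  by (simp add: set_eq_iff in_keys_iff)

lemma sum_single_keys:
  "f = (\<Sum>\<mu>\<in>Poly_Mapping.keys f. Poly_Mapping.single \<mu> (Poly_Mapping.lookup f \<mu>))"
  by (rule poly_mapping_eqI) (simp add: lookup_sum lookup_single when_def in_keys_iff)

lemma monomial_zero_mult: "monomial 0 * f = f"
proof -
  have "monomial 0 * (\<Sum>\<mu>\<in>Poly_Mapping.keys f. Poly_Mapping.single \<mu> (Poly_Mapping.lookup f \<mu>)) =
      (\<Sum>\<mu>\<in>Poly_Mapping.keys f. Poly_Mapping.single \<mu> (Poly_Mapping.lookup f \<mu>))"
    by (simp add: sum_distrib_left monomial_def mult_single)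
  then show ?thesis using sum_single_keys[of f] by simp
qed

lemma cring_poly_alg: "cring (poly_alg I :: (('i \<Rightarrow>\<^sub>0 nat) \<Rightarrow>\<^sub>0 'a::{comm_ring, comm_monoid_mult}) ring)"
proof (rule cringI)
  show "abelian_group (poly_alg I :: (('i \<Rightarrow>\<^sub>0 nat) \<Rightarrow>\<^sub>0 'a) ring)"
  proof (rule abelian_groupI)
    fix f :: "('i \<Rightarrow>\<^sub>0 nat) \<Rightarrow>\<^sub>0 'a" assume "f \<in> carrier (poly_alg I)"
    then show "\<exists>g \<in> carrier (poly_alg I). g \<oplus>\<^bsub>poly_alg I\<^esub> f = \<zero>\<^bsub>poly_alg I\<^esub>"
      by (intro bexI[of _ "- f"]) (auto simp: poly_alg_def keys_neg)
  next
    fix f g :: "('i \<Rightarrow>\<^sub>0 nat) \<Rightarrow>\<^sub>0 'a" assume "f \<in> carrier (poly_alg I)" "g \<in> carrier (poly_alg I)"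
    then show "f \<oplus>\<^bsub>poly_alg I\<^esub> g \<in> carrier (poly_alg I)"
      using keys_add[of f g] by (auto simp: poly_alg_def)
  qed (auto simp: poly_alg_def add_ac)
  show "comm_monoid (poly_alg I :: (('i \<Rightarrow>\<^sub>0 nat) \<Rightarrow>\<^sub>0 'a) ring)"
  proof (rule comm_monoidI)
    fix f g :: "('i \<Rightarrow>\<^sub>0 nat) \<Rightarrow>\<^sub>0 'a" assume "f \<in> carrier (poly_alg I)" "g \<in> carrier (poly_alg I)"
    then show "f \<otimes>\<^bsub>poly_alg I\<^esub> g \<in> carrier (poly_alg I)"
      using keys_mult[of f g] by (fastforce simp: poly_alg_def intro: exps_add)
  next
    show "\<one>\<^bsub>poly_alg I\<^esub> \<in> carrier (poly_alg I :: (('i \<Rightarrow>\<^sub>0 nat) \<Rightarrow>\<^sub>0 'a) ring)"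
      by (simp add: poly_alg_def monomial_def exps_zero)
  qed (simp_all add: poly_alg_def mult_ac monomial_zero_mult
        monomial_zero_mult[THEN trans[OF mult.commute]])
qed (auto simp: poly_alg_def distrib_right)

lemma mdeg_zero:
  assumes "group G" "\<psi> \<in> hom (free_Abelian_group I) G"
  shows "mdeg \<psi> 0 = \<one>\<^bsub>G\<^esub>"
  using hom_one[OF assms(2) group_free_Abelian_group assms(1)]
  by (simp add: mdeg_def map_int_zero free_Abelian_group_def)

lemma mdeg_add:
  assumes "\<psi> \<in> hom (free_Abelian_group I) G" "\<mu> \<in> exps I" "\<nu> \<in> exps I"
  shows "mdeg \<psi> (\<mu> + \<nu>) = mdeg \<psi> \<mu> \<otimes>\<^bsub>G\<^esub> mdeg \<psi> \<nu>"
  using hom_mult[OF assms(1), of "Poly_Mapping.map int \<mu>" "Poly_Mapping.map int \<nu>"] assms(2,3)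
  by (simp add: mdeg_def map_int_add exps_def free_Abelian_group_def keys_map_int)

lemma subcring_deg_restr:
  assumes "group G" "\<psi> \<in> hom (free_Abelian_group I) G" "subgroup H G"
  shows "subcring (carrier (deg_restr I \<psi> H :: (('i \<Rightarrow>\<^sub>0 nat) \<Rightarrow>\<^sub>0 'a::{comm_ring, comm_monoid_mult}) ring))
           (poly_alg I)"
proof -
  interpret R: cring "poly_alg I :: (('i \<Rightarrow>\<^sub>0 nat) \<Rightarrow>\<^sub>0 'a) ring" by (rule cring_poly_alg)
  let ?S = "carrier (deg_restr I \<psi> H :: (('i \<Rightarrow>\<^sub>0 nat) \<Rightarrow>\<^sub>0 'a) ring)"
  have S: "f \<in> ?S \<longleftrightarrow> f \<in> carrier (poly_alg I) \<and> (\<forall>\<mu> \<in> Poly_Mapping.keys f. mdeg \<psi> \<mu> \<in> H)" for f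
    by (simp add: deg_restr_def)
  have uminus: "\<ominus>\<^bsub>poly_alg I\<^esub> f = - f" if "f \<in> carrier (poly_alg I)" for f :: "('i \<Rightarrow>\<^sub>0 nat) \<Rightarrow>\<^sub>0 'a"
    by (rule R.minus_equality) (use that in \<open>auto simp: poly_alg_def keys_neg\<close>)
  show ?thesis
  proof (rule R.subcringI', rule R.subringI)
    show "?S \<subseteq> carrier (poly_alg I)" using S by blast
    have "\<forall>\<mu> \<in> Poly_Mapping.keys (monomial 0 :: ('i \<Rightarrow>\<^sub>0 nat) \<Rightarrow>\<^sub>0 'a). mdeg \<psi> \<mu> \<in> H"
      using mdeg_zero[OF assms(1,2)] subgroup.one_closed[OF assms(3)]
      by (simp add: monomial_def)
    then show "\<one>\<^bsub>poly_alg I\<^esub> \<in> ?S"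
      using R.one_closed S by (auto simp: poly_alg_def)
  next
    fix f assume "f \<in> ?S"
    then show "\<ominus>\<^bsub>poly_alg I\<^esub> f \<in> ?S"
      using R.a_inv_closed by (simp add: S uminus keys_neg)
  next
    fix f g assume fg: "f \<in> ?S" "g \<in> ?S"
    have "Poly_Mapping.keys (f \<otimes>\<^bsub>poly_alg I\<^esub> g) \<subseteq> {\<mu> + \<nu> | \<mu> \<nu>. \<mu> \<in> Poly_Mapping.keys f \<and> \<nu> \<in> Poly_Mapping.keys g}"
      using keys_mult[of f g] by (simp add: poly_alg_def)
    moreover have "mdeg \<psi> (\<mu> + \<nu>) \<in> H" if "\<mu> \<in> Poly_Mapping.keys f" "\<nu> \<in> Poly_Mapping.keys g" for \<mu> \<nu>
    proof -
      have "\<mu> \<in> exps I" "\<nu> \<in> exps I" using fg that by (auto simp: S poly_alg_def)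
      then show ?thesis
        using fg that mdeg_add[OF assms(2)] subgroup.m_closed[OF assms(3)] by (simp add: S)
    qed
    ultimately show "f \<otimes>\<^bsub>poly_alg I\<^esub> g \<in> ?S"
      using fg R.m_closed unfolding S by blast
    have "Poly_Mapping.keys (f \<oplus>\<^bsub>poly_alg I\<^esub> g) \<subseteq> Poly_Mapping.keys f \<union> Poly_Mapping.keys g"
      using keys_add[of f g] by (simp add: poly_alg_def)
    then show "f \<oplus>\<^bsub>poly_alg I\<^esub> g \<in> ?S"
      using fg R.a_closed unfolding S by blast
  qed
qed

lemma cring_deg_restr:
  assumes "group G" "\<psi> \<in> hom (free_Abelian_group I) G" "subgroup H G"
  shows "cring (deg_restr I \<psi> H :: (('i \<Rightarrow>\<^sub>0 nat) \<Rightarrow>\<^sub>0 'a::{comm_ring, comm_monoid_mult}) ring)"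
proof -
  interpret R: cring "poly_alg I :: (('i \<Rightarrow>\<^sub>0 nat) \<Rightarrow>\<^sub>0 'a) ring" by (rule cring_poly_alg)
  show ?thesis
    using R.subcring_iff[of "carrier (deg_restr I \<psi> H)"] subcring_deg_restr[OF assms, where 'a = 'a]
      subcringE(1)[OF subcring_deg_restr[OF assms, where 'a = 'a]]
    by (simp add: deg_restr_def)
qed

text \<open>The degree restriction is the subalgebra generated by the monomials with degree in \<open>H\<close>.\<close>

lemma deg_restr_eq_generate_ring:
  assumes "group G" "\<psi> \<in> hom (free_Abelian_group I) G" "subgroup H G"
  shows "carrier (deg_restr I \<psi> H :: (('i \<Rightarrow>\<^sub>0 nat) \<Rightarrow>\<^sub>0 'a::{comm_ring, comm_monoid_mult}) ring) =
    generate_ring (poly_alg I)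
      (range (Poly_Mapping.single 0) \<union> monomial ` {\<mu> \<in> exps I. mdeg \<psi> \<mu> \<in> H})"
    (is "?S = generate_ring ?R ?B")
proof
  interpret R: cring "poly_alg I :: (('i \<Rightarrow>\<^sub>0 nat) \<Rightarrow>\<^sub>0 'a) ring" by (rule cring_poly_alg)
  have H0: "mdeg \<psi> 0 \<in> H"
    using mdeg_zero[OF assms(1,2)] subgroup.one_closed[OF assms(3)] by simp
  have "?B \<subseteq> ?S"
    using H0 by (auto simp: deg_restr_def poly_alg_def monomial_def exps_zero split: if_splits)
  then show "generate_ring ?R ?B \<subseteq> ?S"
    by (intro R.generate_ring_min_subring1 subcring.axioms(1)[OF subcring_deg_restr[OF assms]])
      (auto simp: deg_restr_def)
  show "?S \<subseteq> generate_ring ?R ?B"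
  proof
    fix f assume "f \<in> ?S"
    then have f: "\<And>\<mu>. \<mu> \<in> Poly_Mapping.keys f \<Longrightarrow> \<mu> \<in> exps I \<and> mdeg \<psi> \<mu> \<in> H"
      by (auto simp: deg_restr_def poly_alg_def)
    have single: "Poly_Mapping.single \<mu> c \<in> generate_ring ?R ?B"
      if "\<mu> \<in> exps I" "mdeg \<psi> \<mu> \<in> H" for \<mu> c
    proof -
      have "Poly_Mapping.single \<mu> c = Poly_Mapping.single 0 c \<otimes>\<^bsub>?R\<^esub> monomial \<mu>"
        by (simp add: poly_alg_def monomial_def mult_single)
      then show ?thesis
        using that by (simp only:) (blast intro: generate_ring.eng_mult generate_ring.incl)
    qed
    have zero: "0 \<in> generate_ring ?R ?B"
      using single[of 0 0] H0 by (simp add: exps_zero)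
    have "(\<Sum>\<mu>\<in>F. Poly_Mapping.single \<mu> (Poly_Mapping.lookup f \<mu>)) \<in> generate_ring ?R ?B"
      if "finite F" "F \<subseteq> Poly_Mapping.keys f" for F
      using that
    proof (induction F)
      case (insert \<mu> F)
      have "Poly_Mapping.single \<mu> (Poly_Mapping.lookup f \<mu>) \<oplus>\<^bsub>?R\<^esub>
          (\<Sum>\<nu>\<in>F. Poly_Mapping.single \<nu> (Poly_Mapping.lookup f \<nu>)) \<in> generate_ring ?R ?B"
        using insert single f[of \<mu>] by (intro generate_ring.eng_add) simp_all
      then show ?case using insert.hyps by (simp add: poly_alg_def)
    qed (simp add: zero)
    from this[OF finite_keys order_refl] show "f \<in> generate_ring ?R ?B"
      by (simp only: sum_single_keys[symmetric])
  qed
qed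

end

theory Submission
  imports Defs
begin

text \<open>
  Everything reduces to exponents: in a ring of polynomials with exponents in a monoid \<open>Q\<close>, the
  ideal generated by monomials with exponents in \<open>B\<close> consists of the polynomials with all exponents
  in \<open>B + Q\<close>. Hence \<open>\<lfloor>\<aa>\<rfloor>\<^sub>H \<subseteq> \<aa>\<^sub>(\<^sub>H\<^sub>) \<subseteq> \<lfloor>\<aa>\<rfloor>\<^sub>(\<^sub>H\<^sub>)\<close>, and it suffices to find a power of
  \<open>\<lfloor>\<aa>\<rfloor>\<^sub>(\<^sub>H\<^sub>)\<close> inside \<open>\<lfloor>\<aa>\<rfloor>\<^sub>H\<close>. As \<open>E(\<aa>)\<close> is finite, every exponent of a high power of
  \<open>\<lfloor>\<aa>\<rfloor>\<^sub>(\<^sub>H\<^sub>)\<close> dominates, by the pigeonhole principle, the exponent of one of the generators of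
  \<open>\<lfloor>\<aa>\<rfloor>\<^sub>H\<close>; the difference again has degree in \<open>H\<close> because \<open>H\<close> is a subgroup.
\<close>

section \<open>Polynomials with exponents in a submonoid\<close>

text \<open>No closure property is asked of \<open>U\<close>, so the same notation serves for the
  rings, for their monomial ideals, and for the mere exponent bounds that control powers of
  ideals.\<close>

definition supported :: "'b set \<Rightarrow> ('b \<Rightarrow>\<^sub>0 'a::zero) set" where
  "supported U = {f. Poly_Mapping.keys f \<subseteq> U}"

text \<open>The monoid ideal generated by \<open>B\<close> when \<open>B\<close> lies in the monoid
  \<open>Q\<close>. The cofactor \<open>q\<close> has to lie in \<open>Q\<close>: in the degree
  restriction, divisibility must be witnessed by a quotient whose degree is in
  \<open>H\<close>.\<close>

definition upset :: "'b::plus set \<Rightarrow> 'b set \<Rightarrow> 'b set" where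
  "upset Q B = {b + q | b q. b \<in> B \<and> q \<in> Q}"

text \<open>Both \<open>R\<close> and its degree restriction \<open>S\<close> are instances, so the
  ideals generated by monomials are computed once for both rings.\<close>

definition mon_ring :: "('i \<Rightarrow>\<^sub>0 nat) set \<Rightarrow> (('i \<Rightarrow>\<^sub>0 nat) \<Rightarrow>\<^sub>0 'a::{comm_ring, comm_monoid_mult}) ring" where
  "mon_ring Q = \<lparr>carrier = supported Q, monoid.mult = (*), one = monomial 0,
                 ring.zero = 0, ring.add = (+)\<rparr>"

lemma mon_ring_simps [simp]:
  "carrier (mon_ring Q) = supported Q" "x \<otimes>\<^bsub>mon_ring Q\<^esub> y = x * y" "\<one>\<^bsub>mon_ring Q\<^esub> = monomial 0"
  "\<zero>\<^bsub>mon_ring Q\<^esub> = 0" "x \<oplus>\<^bsub>mon_ring Q\<^esub> y = x + y"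
  by (simp_all add: mon_ring_def)

lemma poly_alg_eq_mon_ring: "poly_alg I = mon_ring (exps I)"
  by (simp add: poly_alg_def mon_ring_def supported_def)

lemma deg_restr_eq_mon_ring: "deg_restr I \<psi> H = mon_ring {\<mu> \<in> exps I. mdeg \<psi> \<mu> \<in> H}"
  by (auto simp: deg_restr_def poly_alg_def mon_ring_def supported_def)

lemma supported_zero [simp]: "0 \<in> supported U"
  by (simp add: supported_def)

lemma supported_add: "f \<in> supported U \<Longrightarrow> g \<in> supported U \<Longrightarrow> f + g \<in> supported U"
  using keys_add[of f g] by (auto simp: supported_def)

lemma supported_uminus: "f \<in> supported U \<Longrightarrow> - f \<in> supported U" for f :: "'b \<Rightarrow>\<^sub>0 'a::ab_group_add"
  by (simp add: supported_def keys_neg)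

lemma supported_mult:
  "f \<in> supported U \<Longrightarrow> g \<in> supported V \<Longrightarrow> (\<And>u v. u \<in> U \<Longrightarrow> v \<in> V \<Longrightarrow> u + v \<in> W) \<Longrightarrow> f * g \<in> supported W"
  using keys_mult[of f g] unfolding supported_def by blast

lemma supported_mono: "U \<subseteq> V \<Longrightarrow> supported U \<subseteq> supported V"
  by (auto simp: supported_def)

lemma supported_Int: "supported U \<inter> supported V = supported (U \<inter> V)"
  by (auto simp: supported_def)

text \<open>The disjunct \<open>1 = 0\<close> accounts for the zero coefficient ring, where every
  monomial is 0 and has no exponents.\<close>

lemma monomial_in_supported_iff:
  "(monomial \<mu> :: _ \<Rightarrow>\<^sub>0 'a::{comm_ring, comm_monoid_mult}) \<in> supported U \<longleftrightarrow> (1::'a) = 0 \<or> \<mu> \<in> U"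
  by (simp add: monomial_def supported_def)

lemma monomial_eq_iff:
  assumes "(1::'a::{comm_ring, comm_monoid_mult}) \<noteq> 0"
  shows "(monomial \<mu> :: _ \<Rightarrow>\<^sub>0 'a) = monomial \<nu> \<longleftrightarrow> \<mu> = \<nu>"
proof
  assume "(monomial \<mu> :: _ \<Rightarrow>\<^sub>0 'a) = monomial \<nu>"
  then have "Poly_Mapping.keys (monomial \<mu> :: _ \<Rightarrow>\<^sub>0 'a) = Poly_Mapping.keys (monomial \<nu> :: _ \<Rightarrow>\<^sub>0 'a)"
    by simp
  then show "\<mu> = \<nu>" using assms by (simp add: monomial_def)
qed simp

section \<open>Ideals generated by monomials over an exponent monoid\<close>

locale exponent_monoid =
  fixes Q :: "('i \<Rightarrow>\<^sub>0 nat) set"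
  assumes zero_mem: "0 \<in> Q" and add_mem: "\<mu> \<in> Q \<Longrightarrow> \<nu> \<in> Q \<Longrightarrow> \<mu> + \<nu> \<in> Q"
begin

lemma cring_mon_ring: "cring (mon_ring Q :: (('i \<Rightarrow>\<^sub>0 nat) \<Rightarrow>\<^sub>0 'a::{comm_ring, comm_monoid_mult}) ring)"
proof (rule cringI)
  show "abelian_group (mon_ring Q :: (('i \<Rightarrow>\<^sub>0 nat) \<Rightarrow>\<^sub>0 'a) ring)"
    by (rule abelian_groupI)
      (auto simp: add_ac supported_add intro: bexI[of _ "- x" for x] supported_uminus)
  show "comm_monoid (mon_ring Q :: (('i \<Rightarrow>\<^sub>0 nat) \<Rightarrow>\<^sub>0 'a) ring)"
    by (rule comm_monoidI)
      (auto simp: mult_ac monomial_zero_mult monomial_zero_mult[THEN trans[OF mult.commute]]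
          monomial_in_supported_iff zero_mem
        intro: supported_mult add_mem)
qed (simp add: distrib_right)

lemma ideal_supported:
  assumes "U \<subseteq> Q" and "\<And>\<mu> \<nu>. \<mu> \<in> U \<Longrightarrow> \<nu> \<in> Q \<Longrightarrow> \<mu> + \<nu> \<in> U"
  shows "ideal (supported U) (mon_ring Q :: (('i \<Rightarrow>\<^sub>0 nat) \<Rightarrow>\<^sub>0 'a::{comm_ring, comm_monoid_mult}) ring)"
proof (rule idealI)
  interpret cring "mon_ring Q :: (('i \<Rightarrow>\<^sub>0 nat) \<Rightarrow>\<^sub>0 'a) ring" by (rule cring_mon_ring)
  show "ring (mon_ring Q :: (('i \<Rightarrow>\<^sub>0 nat) \<Rightarrow>\<^sub>0 'a) ring)" ..
  have "\<ominus>\<^bsub>mon_ring Q\<^esub> f = - f" if "f \<in> supported Q" for f :: "('i \<Rightarrow>\<^sub>0 nat) \<Rightarrow>\<^sub>0 'a"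
    by (rule minus_equality) (use that in \<open>auto intro: supported_uminus\<close>)
  then have "\<ominus>\<^bsub>mon_ring Q\<^esub> f \<in> supported U" if "f \<in> supported U" for f :: "('i \<Rightarrow>\<^sub>0 nat) \<Rightarrow>\<^sub>0 'a"
    using that supported_mono[OF assms(1)] supported_uminus[OF that] by (metis subsetD)
  moreover have "supported U \<noteq> {}" using supported_zero by blast
  ultimately show "subgroup (supported U :: (('i \<Rightarrow>\<^sub>0 nat) \<Rightarrow>\<^sub>0 'a) set) (add_monoid (mon_ring Q))"
    using supported_mono[OF assms(1)]
    by (intro add.subgroupI) (auto simp: a_inv_def[symmetric] intro: supported_add)
  fix a x :: "('i \<Rightarrow>\<^sub>0 nat) \<Rightarrow>\<^sub>0 'a" assume "a \<in> supported U" "x \<in> carrier (mon_ring Q)"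
  then have "a * x \<in> supported U" by (auto intro: supported_mult assms(2))
  then show "x \<otimes>\<^bsub>mon_ring Q\<^esub> a \<in> supported U" "a \<otimes>\<^bsub>mon_ring Q\<^esub> x \<in> supported U"
    by (simp_all add: mult.commute)
qed

lemma upset_subset: "B \<subseteq> Q \<Longrightarrow> upset Q B \<subseteq> Q"
  by (auto simp: upset_def add_mem)

lemma upset_add: "\<mu> \<in> upset Q B \<Longrightarrow> \<nu> \<in> Q \<Longrightarrow> \<mu> + \<nu> \<in> upset Q B"
  unfolding upset_def using add_mem by (fastforce simp: add.assoc)

lemma subset_upset: "B \<subseteq> upset Q B"
  unfolding upset_def using zero_mem by force

lemma ideal_supported_upset:
  "B \<subseteq> Q \<Longrightarrow> ideal (supported (upset Q B))
    (mon_ring Q :: (('i \<Rightarrow>\<^sub>0 nat) \<Rightarrow>\<^sub>0 'a::{comm_ring, comm_monoid_mult}) ring)"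
  by (intro ideal_supported upset_subset upset_add)

text \<open>The right side is an ideal containing the generators. Conversely, each of its elements
  is a finite sum of terms with exponent \<open>b + q\<close>, and such a term is the generator with
  exponent \<open>b\<close> times a term of the ring with exponent \<open>q\<close>.\<close>

lemma genideal_monomials:
  assumes "B \<subseteq> Q"
  shows "Idl\<^bsub>mon_ring Q\<^esub> (monomial ` B) =
    (supported (upset Q B) :: (('i \<Rightarrow>\<^sub>0 nat) \<Rightarrow>\<^sub>0 'a::{comm_ring, comm_monoid_mult}) set)" (is "?J = _")
proof
  interpret cring "mon_ring Q :: (('i \<Rightarrow>\<^sub>0 nat) \<Rightarrow>\<^sub>0 'a) ring" by (rule cring_mon_ring)
  show "?J \<subseteq> supported (upset Q B)"
    using subset_upset[of B]
    by (intro genideal_minimal ideal_supported_upset assms) (auto simp: monomial_in_supported_iff)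
  have gens: "monomial ` B \<subseteq> carrier (mon_ring Q :: (('i \<Rightarrow>\<^sub>0 nat) \<Rightarrow>\<^sub>0 'a) ring)"
    using assms by (auto simp: monomial_in_supported_iff)
  interpret J: ideal ?J "mon_ring Q" by (rule genideal_ideal[OF gens])
  show "supported (upset Q B) \<subseteq> ?J"
  proof
    fix f :: "('i \<Rightarrow>\<^sub>0 nat) \<Rightarrow>\<^sub>0 'a" assume f: "f \<in> supported (upset Q B)"
    have single: "Poly_Mapping.single \<mu> c \<in> ?J" if \<mu>: "\<mu> \<in> upset Q B" for \<mu> c
    proof -
      obtain b q where "\<mu> = b + q" "b \<in> B" "q \<in> Q" using \<mu> by (auto simp: upset_def)
      moreover have "monomial b \<in> ?J" using genideal_self[OF gens] \<open>b \<in> B\<close> by blast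
      moreover have "Poly_Mapping.single q c \<in> supported Q" using \<open>q \<in> Q\<close> by (simp add: supported_def)
      ultimately show ?thesis
        using J.I_r_closed[of "monomial b" "Poly_Mapping.single q c"] by (simp add: monomial_def mult_single)
    qed
    have "(\<Sum>\<mu>\<in>F. Poly_Mapping.single \<mu> (Poly_Mapping.lookup f \<mu>)) \<in> ?J"
      if "finite F" "F \<subseteq> Poly_Mapping.keys f" for F
      using that
    proof (induction F)
      case empty
      then show ?case using J.zero_closed by simp
    next
      case (insert \<mu> F)
      then have "Poly_Mapping.single \<mu> (Poly_Mapping.lookup f \<mu>) \<in> ?J"
        using f by (intro single) (auto simp: supported_def)
      then show ?case using insert J.a_closed by simp
    qed
    from this[OF finite_keys order_refl] show "f \<in> ?J"
      by (simp only: sum_single_keys[symmetric])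
  qed
qed

end

lemma exponent_monoid_exps: "exponent_monoid (exps I)"
  by unfold_locales (auto intro: exps_zero exps_add)

lemma exponent_monoid_deg:
  assumes "group G" "\<psi> \<in> hom (free_Abelian_group I) G" "subgroup H G"
  shows "exponent_monoid {\<mu> \<in> exps I. mdeg \<psi> \<mu> \<in> H}"
  by unfold_locales
    (auto simp: exps_zero exps_add mdeg_zero[OF assms(1,2)] mdeg_add[OF assms(2)]
      intro: subgroup.one_closed[OF assms(3)] subgroup.m_closed[OF assms(3)])

section \<open>Minimal generating sets of monomial ideals\<close>

text \<open>Domination makes the truncated difference exact, and its support stays inside
  \<open>I\<close>. This turns ideal membership in \<open>R\<close> into a componentwise
  comparison.\<close>

lemma mem_upset_exps_iff:
  assumes "\<mu> \<in> exps I"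
  shows "\<mu> \<in> upset (exps I) B \<longleftrightarrow>
    (\<exists>\<nu>\<in>B. \<forall>i. Poly_Mapping.lookup \<nu> i \<le> Poly_Mapping.lookup \<mu> i)" (is "_ \<longleftrightarrow> ?R")
proof
  assume ?R
  then obtain \<nu> where \<nu>: "\<nu> \<in> B" "\<And>i. Poly_Mapping.lookup \<nu> i \<le> Poly_Mapping.lookup \<mu> i" by blast
  have "\<mu> = \<nu> + (\<mu> - \<nu>)" using \<nu>(2) by (intro poly_mapping_eqI) (simp add: lookup_add lookup_minus)
  moreover have "\<mu> - \<nu> \<in> exps I"
    using assms by (auto simp: exps_def in_keys_iff lookup_minus subset_iff)
  ultimately show "\<mu> \<in> upset (exps I) B" using \<nu>(1) unfolding upset_def by blast
qed (force simp: upset_def lookup_add)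

text \<open>Minimality is for divisibility of monomials, that is, for the componentwise order. Over
  a nonzero ring this set turns out to be E(\<aa>).\<close>

definition min_elems :: "('i \<Rightarrow>\<^sub>0 nat) set \<Rightarrow> ('i \<Rightarrow>\<^sub>0 nat) set" where
  "min_elems M = {\<mu> \<in> M. \<forall>\<nu>\<in>M. (\<forall>i. Poly_Mapping.lookup \<nu> i \<le> Poly_Mapping.lookup \<mu> i) \<longrightarrow> \<nu> = \<mu>}"

text \<open>Replacing an exponent by a different one below it strictly lowers the total degree, so
  descent terminates, even for infinite \<open>I\<close> and \<open>M\<close>.\<close>

lemma ex_min_elem_le:
  assumes "\<mu> \<in> M"
  shows "\<exists>\<nu>\<in>min_elems M. \<forall>i. Poly_Mapping.lookup \<nu> i \<le> Poly_Mapping.lookup \<mu> i"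
  using assms
proof (induction "\<Sum>i\<in>Poly_Mapping.keys \<mu>. Poly_Mapping.lookup \<mu> i" arbitrary: \<mu> rule: less_induct)
  case less
  show ?case
  proof (cases "\<mu> \<in> min_elems M")
    case False
    then obtain \<nu> where \<nu>: "\<nu> \<in> M" "\<And>i. Poly_Mapping.lookup \<nu> i \<le> Poly_Mapping.lookup \<mu> i" "\<nu> \<noteq> \<mu>"
      using less.prems by (auto simp: min_elems_def)
    obtain j where j: "Poly_Mapping.lookup \<nu> j \<noteq> Poly_Mapping.lookup \<mu> j"
      using \<nu>(3) by (meson poly_mapping_eqI)
    have "Poly_Mapping.lookup \<nu> j < Poly_Mapping.lookup \<mu> j" using j \<nu>(2)[of j] by simp
    then have "j \<in> Poly_Mapping.keys \<mu>" by (simp add: in_keys_iff)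
    have "Poly_Mapping.keys \<nu> \<subseteq> Poly_Mapping.keys \<mu>"
      using \<nu>(2) by (metis in_keys_iff le_zero_eq subsetI)
    then have "(\<Sum>i\<in>Poly_Mapping.keys \<nu>. Poly_Mapping.lookup \<nu> i) =
        (\<Sum>i\<in>Poly_Mapping.keys \<mu>. Poly_Mapping.lookup \<nu> i)"
      by (intro sum.mono_neutral_left) (auto simp: in_keys_iff)
    also have "\<dots> < (\<Sum>i\<in>Poly_Mapping.keys \<mu>. Poly_Mapping.lookup \<mu> i)"
      using \<nu>(2) \<open>j \<in> _\<close> \<open>Poly_Mapping.lookup \<nu> j < _\<close> by (intro sum_strict_mono_ex1) auto
    finally show ?thesis using less.hyps[of \<nu>] \<nu>(1,2) by (meson order_trans)
  qed auto
qed

lemma upset_min_elems: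
  assumes "M \<subseteq> exps I"
  shows "upset (exps I) (min_elems M) = upset (exps I) M"
proof -
  interpret exponent_monoid "exps I" by (rule exponent_monoid_exps)
  have sub: "min_elems M \<subseteq> M" by (auto simp: min_elems_def)
  show ?thesis
  proof (intro equalityI subsetI)
    fix \<mu> assume "\<mu> \<in> upset (exps I) (min_elems M)"
    then show "\<mu> \<in> upset (exps I) M" using sub by (auto simp: upset_def)
  next
    fix \<mu> assume \<mu>: "\<mu> \<in> upset (exps I) M"
    then have "\<mu> \<in> exps I" using upset_subset[OF assms] by blast
    then show "\<mu> \<in> upset (exps I) (min_elems M)"
      using \<mu> ex_min_elem_le[of _ M] by (simp add: mem_upset_exps_iff) (meson order_trans)
  qed
qed

text \<open>The minimal elements generate the ideal, and every generating set of monomials contains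
  theirs. So theirs is minimal, and any other candidate would properly contain a generating
  set.\<close>

lemma min_exps_eq_min_elems:
  assumes "M \<subseteq> exps I" "(1::'a::{comm_ring, comm_monoid_mult}) \<noteq> 0"
  shows "min_exps I (Idl\<^bsub>poly_alg I\<^esub> (monomial ` M :: (_ \<Rightarrow>\<^sub>0 'a) set)) = min_elems M"
proof -
  interpret exponent_monoid "exps I" by (rule exponent_monoid_exps)
  let ?mon = "monomial :: _ \<Rightarrow> _ \<Rightarrow>\<^sub>0 'a"
  let ?Idl = "\<lambda>B. Idl\<^bsub>poly_alg I\<^esub> (B :: (_ \<Rightarrow>\<^sub>0 'a) set)"
  have Idl: "?Idl (?mon ` B) = supported (upset (exps I) B)" if "B \<subseteq> exps I" for B
    using genideal_monomials[OF that] by (simp add: poly_alg_eq_mon_ring)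
  have Idl_eq: "?Idl (?mon ` B) = ?Idl (?mon ` C) \<longleftrightarrow> upset (exps I) B = upset (exps I) C"
    if "B \<subseteq> exps I" "C \<subseteq> exps I" for B C
  proof -
    \<comment> \<open>As 1 \<noteq> 0, the set \<open>U\<close> is recovered from the monomials in
      \<open>supported U\<close>; equality of ideals becomes equality of exponent sets.\<close>
    have "(supported U = (supported V :: (_ \<Rightarrow>\<^sub>0 'a) set)) \<longleftrightarrow> U = V" for U V :: "('b \<Rightarrow>\<^sub>0 nat) set"
      using assms(2) monomial_in_supported_iff[where 'a = 'a] by blast
    then show ?thesis by (simp add: Idl that)
  qed
  have inj: "inj ?mon" using monomial_eq_iff[OF assms(2)] by (auto intro: injI)
  let ?E = "min_elems M"
  have E: "?E \<subseteq> exps I" using assms(1) by (auto simp: min_elems_def)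
  \<comment> \<open>A minimal \<open>e\<close> lies above some \<open>c\<close> in \<open>C\<close>,
    which lies above some \<open>m\<close> in \<open>M\<close>. Minimality gives
    \<open>m = e\<close>, which squeezes \<open>c\<close> to \<open>e\<close>.\<close>
  have subset: "?E \<subseteq> C" if C: "C \<subseteq> exps I" "upset (exps I) C = upset (exps I) M" for C
  proof
    fix e assume e: "e \<in> ?E"
    then have "e \<in> upset (exps I) C" "e \<in> exps I"
      using subset_upset[of M] E C(2) by (auto simp: min_elems_def)
    then obtain c where c: "c \<in> C" "\<forall>i. Poly_Mapping.lookup c i \<le> Poly_Mapping.lookup e i"
      by (auto simp: mem_upset_exps_iff)
    have "c \<in> upset (exps I) M" "c \<in> exps I" using c(1) C subset_upset[of C] by auto
    then obtain m where m: "m \<in> M" "\<forall>i. Poly_Mapping.lookup m i \<le> Poly_Mapping.lookup c i"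
      by (auto simp: mem_upset_exps_iff)
    have "m = e" using e m c by (auto simp: min_elems_def) (meson order_trans)
    then have "c = e" using m(2) c(2) by (intro poly_mapping_eqI) (simp add: eq_iff)
    then show "e \<in> C" using c(1) by simp
  qed
  show ?thesis
    unfolding min_exps_def
  proof (rule the_equality, intro conjI allI impI)
    show "?E \<subseteq> exps I" by (rule E)
    show "?Idl (?mon ` ?E) = ?Idl (?mon ` M)"
      by (simp add: Idl_eq E assms(1) upset_min_elems)
    fix B assume B: "B \<subset> ?mon ` ?E"
    then obtain C where C: "C \<subseteq> ?E" "B = ?mon ` C" by (meson psubset_imp_subset subset_imageE)
    then have "C \<subseteq> exps I" "\<not> ?E \<subseteq> C" using B E by auto
    then show "?Idl B \<noteq> ?Idl (?mon ` M)" using subset[of C] by (auto simp: C(2) Idl_eq assms(1))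
  next
    fix C assume C: "C \<subseteq> exps I \<and> ?Idl (?mon ` C) = ?Idl (?mon ` M) \<and>
      (\<forall>B. B \<subset> ?mon ` C \<longrightarrow> ?Idl B \<noteq> ?Idl (?mon ` M))"
    then have "?E \<subseteq> C" using subset[of C] Idl_eq[of C M] assms(1) by blast
    then have "?mon ` ?E \<subseteq> ?mon ` C" by (rule image_mono)
    moreover have "?Idl (?mon ` ?E) = ?Idl (?mon ` M)"
      by (simp add: Idl_eq E assms(1) upset_min_elems)
    with C have "\<not> ?mon ` ?E \<subset> ?mon ` C" by metis
    ultimately have "?mon ` ?E = ?mon ` C" by (simp only: psubset_eq) simp
    then show "C = ?E" using inj_image_eq_iff[OF inj, of ?E C] by simp
  qed
qed

text \<open>The polynomial ring contains only 0, so all ideals agree and the empty set generates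
  each of them. A nonempty candidate therefore fails minimality.\<close>

lemma min_exps_zero_ring:
  assumes "(1::'a::{comm_ring, comm_monoid_mult}) = 0"
    and "ideal \<aa> (poly_alg I :: (('i \<Rightarrow>\<^sub>0 nat) \<Rightarrow>\<^sub>0 'a) ring)"
  shows "min_exps I \<aa> = {}"
proof -
  interpret exponent_monoid "exps I" by (rule exponent_monoid_exps)
  interpret R: cring "poly_alg I :: (('i \<Rightarrow>\<^sub>0 nat) \<Rightarrow>\<^sub>0 'a) ring" by (rule cring_poly_alg)
  have "x = 0" for x :: 'a
    using assms(1) by (metis mult_1 mult_zero_left)
  then have zero: "f = 0" for f :: "('i \<Rightarrow>\<^sub>0 nat) \<Rightarrow>\<^sub>0 'a" by (intro poly_mapping_eqI) simp
  have eq: "J = \<aa>" if "ideal J (poly_alg I)" for J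
    using additive_subgroup.zero_closed[OF ideal.axioms(1)[OF that]]
      additive_subgroup.zero_closed[OF ideal.axioms(1)[OF assms(2)]] zero
    by (metis (full_types) subsetI subset_antisym)
  have empty: "Idl\<^bsub>poly_alg I\<^esub> {} = \<aa>" by (rule eq, rule R.genideal_ideal) simp
  show ?thesis
    unfolding min_exps_def
  proof (rule the_equality)
    fix E :: "('i \<Rightarrow>\<^sub>0 nat) set"
    assume "E \<subseteq> exps I \<and> Idl\<^bsub>poly_alg I\<^esub> (monomial ` E) = \<aa> \<and>
      (\<forall>B. B \<subset> monomial ` E \<longrightarrow> Idl\<^bsub>poly_alg I\<^esub> B \<noteq> \<aa>)"
    then have "\<not> {} \<subset> (monomial ` E :: (_ \<Rightarrow>\<^sub>0 'a) set)" using empty by blast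
    then show "E = {}" by blast
  qed (simp add: empty)
qed

text \<open>The given finite generating set may contain polynomials that are not monomials, but the
  exponents occurring in them form a finite set that already determines the ideal. The last
  conclusion supplies 1 \<noteq> 0 as soon as an element of E(\<aa>) is at hand.\<close>

lemma min_exps_finite_type:
  fixes \<aa> :: "(('i \<Rightarrow>\<^sub>0 nat) \<Rightarrow>\<^sub>0 'a::{comm_ring, comm_monoid_mult}) set"
  assumes "monomial_ideal I \<aa>" "finite_type (poly_alg I) \<aa>"
  shows "finite (min_exps I \<aa>)" "min_exps I \<aa> \<subseteq> exps I"
    "\<aa> = supported (upset (exps I) (min_exps I \<aa>))" "min_exps I \<aa> \<noteq> {} \<Longrightarrow> (1::'a) \<noteq> 0"
proof -
  interpret exponent_monoid "exps I" by (rule exponent_monoid_exps)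
  interpret R: cring "poly_alg I :: (('i \<Rightarrow>\<^sub>0 nat) \<Rightarrow>\<^sub>0 'a) ring" by (rule cring_poly_alg)
  obtain M where M: "M \<subseteq> exps I" "\<aa> = Idl\<^bsub>poly_alg I\<^esub> (monomial ` M)"
    using assms(1) by (auto simp: monomial_ideal_def)
  obtain F where F: "finite F" "F \<subseteq> carrier (poly_alg I)" "\<aa> = Idl\<^bsub>poly_alg I\<^esub> F"
    using assms(2) by (auto simp: finite_type_def)
  have a: "\<aa> = supported (upset (exps I) M)"
    using M genideal_monomials[OF M(1)] by (simp add: poly_alg_eq_mon_ring)
  have main: "finite (min_exps I \<aa>) \<and> min_exps I \<aa> \<subseteq> exps I \<and>
    \<aa> = supported (upset (exps I) (min_exps I \<aa>)) \<and> (min_exps I \<aa> \<noteq> {} \<longrightarrow> (1::'a) \<noteq> 0)"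
  proof (cases "(1::'a) = 0")
    case True
    then have "min_exps I \<aa> = {}"
      using R.genideal_ideal[OF F(2)] F(3) by (intro min_exps_zero_ring) simp_all
    moreover have "f = 0" for f :: "('i \<Rightarrow>\<^sub>0 nat) \<Rightarrow>\<^sub>0 'a"
      using True by (intro poly_mapping_eqI) (metis mult_1 mult_zero_left)
    then have "\<aa> = supported (upset (exps I) {})"
      unfolding a by (metis (full_types) subsetI subset_antisym supported_zero)
    ultimately show ?thesis by simp
  next
    case False
    then have E: "min_exps I \<aa> = min_elems M" using min_exps_eq_min_elems[OF M(1)] M(2) by simp
    let ?K = "\<Union>f\<in>F. Poly_Mapping.keys f"
    have K: "?K \<subseteq> exps I" using F(2) by (auto simp: poly_alg_def)
    have "F \<subseteq> \<aa>" using R.genideal_self[OF F(2)] F(3) by simp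
    then have KM: "?K \<subseteq> upset (exps I) (min_elems M)"
      unfolding a upset_min_elems[OF M(1)] by (auto simp: supported_def)
    have "\<aa> \<subseteq> supported (upset (exps I) ?K)"
      using ideal_supported_upset[OF K] subset_upset[of ?K] unfolding F(3)
      by (intro R.genideal_minimal) (auto simp: poly_alg_eq_mon_ring supported_def)
    moreover have "(monomial m :: _ \<Rightarrow>\<^sub>0 'a) \<in> \<aa>" if "m \<in> M" for m
      using that subset_upset[of M] by (auto simp: a monomial_in_supported_iff)
    ultimately have "(monomial m :: _ \<Rightarrow>\<^sub>0 'a) \<in> supported (upset (exps I) ?K)" if "m \<in> M" for m
      using that by (meson subsetD)
    then have MK: "M \<subseteq> upset (exps I) ?K"
      unfolding monomial_in_supported_iff using False by (meson subsetI)
    have "\<exists>e\<in>min_elems M. \<forall>i. Poly_Mapping.lookup e i \<le> Poly_Mapping.lookup k i" if "k \<in> ?K" for k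
      using subsetD[OF KM that] mem_upset_exps_iff[OF subsetD[OF K that]] by simp
    then obtain e where e: "\<And>k. k \<in> ?K \<Longrightarrow> e k \<in> min_elems M"
      "\<And>k i. k \<in> ?K \<Longrightarrow> Poly_Mapping.lookup (e k) i \<le> Poly_Mapping.lookup k i"
      by metis
    \<comment> \<open>Each minimal exponent lies above some \<open>k\<close> in \<open>?K\<close>,
      hence above the chosen minimal \<open>e k\<close>, and so equals it: finitely many
      \<open>k\<close> leave finitely many minimal exponents.\<close>
    have "min_elems M \<subseteq> e ` ?K"
    proof
      fix \<mu> assume \<mu>: "\<mu> \<in> min_elems M"
      then have "\<mu> \<in> upset (exps I) ?K" "\<mu> \<in> exps I" using MK M(1) by (auto simp: min_elems_def)
      then obtain k where k: "k \<in> ?K" "\<forall>i. Poly_Mapping.lookup k i \<le> Poly_Mapping.lookup \<mu> i"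
        unfolding mem_upset_exps_iff[OF \<open>\<mu> \<in> exps I\<close>] by blast
      have "\<forall>i. Poly_Mapping.lookup (e k) i \<le> Poly_Mapping.lookup \<mu> i"
        using e(2)[OF k(1)] k(2) by (meson order_trans)
      then have "e k = \<mu>" using e(1)[OF k(1)] \<mu> by (simp add: min_elems_def)
      then show "\<mu> \<in> e ` ?K" using k(1) by blast
    qed
    moreover have "finite ?K" using F(1) by simp
    ultimately have "finite (min_elems M)" using finite_subset by blast
    moreover have "min_elems M \<subseteq> exps I" using M(1) by (auto simp: min_elems_def)
    ultimately show ?thesis using False a unfolding E upset_min_elems[OF M(1)] by blast
  qed
  show "finite (min_exps I \<aa>)" by (rule main[THEN conjunct1])
  show "min_exps I \<aa> \<subseteq> exps I" by (rule main[THEN conjunct2, THEN conjunct1])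
  show "\<aa> = supported (upset (exps I) (min_exps I \<aa>))"
    by (rule main[THEN conjunct2, THEN conjunct2, THEN conjunct1])
  show "min_exps I \<aa> \<noteq> {} \<Longrightarrow> (1::'a) \<noteq> 0"
    by (rule main[THEN conjunct2, THEN conjunct2, THEN conjunct2, THEN mp])
qed

section \<open>Powers of ideals and torsion\<close>

lemma ideal_prod_mono: "J \<subseteq> J' \<Longrightarrow> K \<subseteq> K' \<Longrightarrow> ideal_prod S J K \<subseteq> ideal_prod S J' K'"
proof
  fix x assume "J \<subseteq> J'" "K \<subseteq> K'" "x \<in> ideal_prod S J K"
  from this(3,1,2) show "x \<in> ideal_prod S J' K'"
    by (induction rule: ideal_prod.induct) (auto intro: ideal_prod.intros)
qed

lemma ideals_set_pow_0: "J [^]\<^bsub>ideals_set S\<^esub> (0::nat) = carrier S"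
  by (simp add: ideals_set_def)

lemma ideals_set_pow_Suc: "J [^]\<^bsub>ideals_set S\<^esub> Suc n = ideal_prod S (J [^]\<^bsub>ideals_set S\<^esub> n) J"
  by (simp add: ideals_set_def)

lemma ideals_set_pow_mono: "J \<subseteq> K \<Longrightarrow> J [^]\<^bsub>ideals_set S\<^esub> (n::nat) \<subseteq> K [^]\<^bsub>ideals_set S\<^esub> n"
  by (induction n) (simp_all only: ideals_set_pow_0 ideals_set_pow_Suc ideal_prod_mono order_refl)

text \<open>An element killed by \<dd>^n is killed by \<cc>^(k n) = (\<cc>^k)^n, which lies in
  \<dd>^n. The power law is that of the monoid of ideals.\<close>

lemma (in cring) torsion_subset:
  assumes "ideal \<cc> R" "\<cc> [^]\<^bsub>ideals_set R\<^esub> (k::nat) \<subseteq> \<dd>"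
  shows "torsion R \<dd> M \<subseteq> torsion R \<cc> M"
proof -
  interpret J: comm_monoid "ideals_set R" by (rule ideals_set_is_comm_monoid)
  have "\<cc> [^]\<^bsub>ideals_set R\<^esub> (k * n) \<subseteq> \<dd> [^]\<^bsub>ideals_set R\<^esub> n" for n
    using J.nat_pow_pow[of \<cc> k n] ideals_set_pow_mono[OF assms(2), of R n] assms(1)
    by (simp add: ideals_set_def)
  then show ?thesis unfolding torsion_def by blast
qed

lemma (in cring) torsion_antimono:
  assumes "ideal \<cc> R" "\<cc> \<subseteq> \<dd>"
  shows "torsion R \<dd> M \<subseteq> torsion R \<cc> M"
proof -
  interpret J: comm_monoid "ideals_set R" by (rule ideals_set_is_comm_monoid)
  have "\<cc> [^]\<^bsub>ideals_set R\<^esub> (1::nat) \<subseteq> \<dd>"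
    using J.nat_pow_eone[of \<cc>] assms by (simp add: ideals_set_def)
  then show ?thesis by (rule torsion_subset[OF assms(1)])
qed

text \<open>
  Dominating each \<open>t e\<close> on the support of \<open>e\<close> separately is weaker than dominating the sum over
  all \<open>e\<close> of \<open>t e\<close> times the support of \<open>e\<close>, but suffices for the pigeonhole principle.
\<close>

lemma pow_subset_supported:
  assumes "finite E"
    and "\<cc> \<subseteq> supported {\<mu>. \<exists>e\<in>E. \<forall>i\<in>Poly_Mapping.keys e. 1 \<le> Poly_Mapping.lookup \<mu> i}"
  shows "\<cc> [^]\<^bsub>ideals_set (mon_ring Q)\<^esub> (n::nat) \<subseteq>
    supported {\<mu>. \<exists>t. sum t E = n \<and> (\<forall>e\<in>E. \<forall>i\<in>Poly_Mapping.keys e. t e \<le> Poly_Mapping.lookup \<mu> i)}"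
    (is "_ \<subseteq> supported (?P n)")
proof (induction n)
  case 0
  \<comment> \<open>The zeroth power is the whole ring, and \<open>t = 0\<close> makes the bound
    vacuous.\<close>
  have "?P 0 = UNIV" by (auto intro: exI[of _ "\<lambda>_. 0"])
  then show ?case by (simp add: supported_def)
next
  case (Suc n)
  have add: "\<mu> + \<nu> \<in> ?P (Suc n)"
    if \<mu>: "\<mu> \<in> ?P n" and \<nu>: "\<nu> \<in> {\<mu>. \<exists>e\<in>E. \<forall>i\<in>Poly_Mapping.keys e. 1 \<le> Poly_Mapping.lookup \<mu> i}" for \<mu> \<nu>
  proof -
    obtain t where t: "sum t E = n" "\<forall>e\<in>E. \<forall>i\<in>Poly_Mapping.keys e. t e \<le> Poly_Mapping.lookup \<mu> i"
      using \<mu> by blast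
    obtain e where e: "e \<in> E" "\<forall>i\<in>Poly_Mapping.keys e. 1 \<le> Poly_Mapping.lookup \<nu> i"
      using \<nu> by blast
    \<comment> \<open>The new factor contributes at least 1 everywhere on the support of
      \<open>e\<close>, so the count at \<open>e\<close> may go up by one; the other bounds survive
      because exponents only grow.\<close>
    have "sum (t(e := Suc (t e))) E = Suc n"
      using t(1) sum.remove[OF assms(1) e(1), of t] sum.remove[OF assms(1) e(1), of "t(e := Suc (t e))"]
      by simp
    moreover have "(t(e := Suc (t e))) d \<le> Poly_Mapping.lookup (\<mu> + \<nu>) i"
      if "d \<in> E" "i \<in> Poly_Mapping.keys d" for d i
      using t(2) e(2) that by (fastforce simp: lookup_add intro: add_mono[of _ _ 1, simplified] trans_le_add1)
    ultimately show ?thesis by blast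
  qed
  show ?case
  proof
    fix f assume "f \<in> \<cc> [^]\<^bsub>ideals_set (mon_ring Q)\<^esub> Suc n"
    then have "f \<in> ideal_prod (mon_ring Q) (\<cc> [^]\<^bsub>ideals_set (mon_ring Q)\<^esub> n) \<cc>"
      by (simp only: ideals_set_pow_Suc)
    then show "f \<in> supported (?P (Suc n))"
    proof (induction rule: ideal_prod.induct)
      case (prod g h)
      then have "g \<in> supported (?P n)"
        "h \<in> supported {\<mu>. \<exists>e\<in>E. \<forall>i\<in>Poly_Mapping.keys e. 1 \<le> Poly_Mapping.lookup \<mu> i}"
        using Suc.IH assms(2) by blast+
      then show ?case unfolding mon_ring_simps by (rule supported_mult) (rule add)
    qed (simp add: supported_add)
  qed
qed

section \<open>Degrees of finite index\<close>

text \<open>Among finitely many cosets, two distinct powers of \<open>g\<close> share one; their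
  quotient is a positive power of \<open>g\<close> lying in \<open>H\<close>.\<close>

lemma (in group) ex_pow_mem_of_finite_index:
  assumes "subgroup H G" "finite (rcosets H)" "g \<in> carrier G"
  shows "\<exists>n>0. g [^] (n::nat) \<in> H"
proof -
  interpret H: subgroup H G by fact
  have "range (\<lambda>n::nat. H #> g [^] n) \<subseteq> rcosets H"
    using assms(3) H.subset by (auto intro: rcosetsI)
  then have "\<not> inj (\<lambda>n::nat. H #> g [^] n)"
    using assms(2) finite_subset range_inj_infinite by blast
  then obtain a b :: nat where ab: "a < b" "H #> g [^] a = H #> g [^] b"
    by (metis (no_types, lifting) injI linorder_neqE_nat)
  have "g [^] b \<in> H #> g [^] a"
    using ab(2) rcos_self[of "g [^] b" H] assms(1,3) by simp
  then have "g [^] b \<otimes> inv (g [^] a) \<in> H"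
    using H.rcos_module_imp[OF group_axioms] assms(3) by simp
  moreover have "g [^] b = g [^] (b - a) \<otimes> g [^] a"
    using ab(1) assms(3) by (simp add: nat_pow_mult)
  ultimately have "g [^] (b - a) \<in> H"
    using assms(3) by (simp add: m_assoc)
  then show ?thesis using ab(1) by (intro exI[of _ "b - a"]) simp
qed

lemma lookup_map_const:
  "Poly_Mapping.lookup (Poly_Mapping.map (\<lambda>_. m) \<mu>) i = (if i \<in> Poly_Mapping.keys \<mu> then m else 0)"
  by (simp add: Poly_Mapping.map.rep_eq in_keys_iff when_def)

lemma map_const_exps: "\<mu> \<in> exps I \<Longrightarrow> Poly_Mapping.map (\<lambda>_. m) \<mu> \<in> exps I"
  by (auto simp: exps_def in_keys_iff lookup_map_const subset_iff split: if_splits)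

lemma mdeg_map_const:
  assumes "group G" "\<psi> \<in> hom (free_Abelian_group I) G" "\<mu> \<in> exps I"
  shows "mdeg \<psi> (Poly_Mapping.map (\<lambda>_. m) \<mu>) = mdeg \<psi> (Poly_Mapping.map (\<lambda>_. 1) \<mu>) [^]\<^bsub>G\<^esub> m"
proof (induction m)
  case 0
  have "Poly_Mapping.map (\<lambda>_. 0) \<mu> = (0 :: _ \<Rightarrow>\<^sub>0 nat)"
    by (rule poly_mapping_eqI) (simp add: lookup_map_const)
  then show ?case using mdeg_zero[OF assms(1,2)] by (simp add: nat_pow_def)
next
  case (Suc m)
  have "Poly_Mapping.map (\<lambda>_. Suc m) \<mu> = Poly_Mapping.map (\<lambda>_. m) \<mu> + Poly_Mapping.map (\<lambda>_. 1) \<mu>"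
    by (rule poly_mapping_eqI) (simp add: lookup_map_const lookup_add)
  then show ?case
    using Suc mdeg_add[OF assms(2)] map_const_exps[OF assms(3)] by (simp add: nat_pow_def)
qed

text \<open>This makes the least exponent in \<open>floor_restr_ideal\<close> exist: a constant
  exponent on the support of \<mu> can both have degree in \<open>H\<close> and dominate
  \<mu>.\<close>

lemma ex_map_const_degree:
  assumes "group G" "\<psi> \<in> hom (free_Abelian_group I) G" "subgroup H G" "finite (rcosets\<^bsub>G\<^esub> H)"
    and "\<mu> \<in> exps I"
  shows "\<exists>m. mdeg \<psi> (Poly_Mapping.map (\<lambda>_. m) \<mu>) \<in> H \<and>
    (\<forall>i. Poly_Mapping.lookup \<mu> i \<le> Poly_Mapping.lookup (Poly_Mapping.map (\<lambda>_. m) \<mu>) i)"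
proof -
  interpret group G by fact
  interpret H: subgroup H G by fact
  let ?g = "mdeg \<psi> (Poly_Mapping.map (\<lambda>_. 1) \<mu>)"
  let ?s = "\<Sum>i\<in>Poly_Mapping.keys \<mu>. Poly_Mapping.lookup \<mu> i"
  have g: "?g \<in> carrier G"
    using hom_in_carrier[OF assms(2)] map_const_exps[OF assms(5), of 1]
    by (simp add: mdeg_def exps_def free_Abelian_group_def keys_map_int)
  obtain n :: nat where n: "n > 0" "?g [^]\<^bsub>G\<^esub> n \<in> H"
    using ex_pow_mem_of_finite_index[OF assms(3,4) g] by blast
  have pow: "h [^]\<^bsub>G\<^esub> k \<in> H" if "h \<in> H" for h and k :: nat
    using that by (induction k) auto
  \<comment> \<open>The factor \<open>n\<close> brings the degree into \<open>H\<close>; the total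
    degree \<open>?s\<close> bounds every entry of \<mu>.\<close>
  have "mdeg \<psi> (Poly_Mapping.map (\<lambda>_. n * ?s) \<mu>) \<in> H"
    using pow[OF n(2), of ?s] g by (simp only: mdeg_map_const[OF assms(1,2,5), of "n * ?s"] nat_pow_pow)
  moreover have "Poly_Mapping.lookup \<mu> i \<le> n * ?s" if "i \<in> Poly_Mapping.keys \<mu>" for i
  proof -
    have "Poly_Mapping.lookup \<mu> i \<le> ?s" using that by (intro member_le_sum) auto
    also have "\<dots> \<le> n * ?s" using n(1) by simp
    finally show ?thesis .
  qed
  ultimately show ?thesis
    by (intro exI[of _ "n * ?s"]) (auto simp: lookup_map_const in_keys_iff)
qed

section \<open>Comparison of the three torsion functors\<close>

theorem mainTheorem3:
  fixes I :: "'i set"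
    and G :: "('g, 'w) monoid_scheme"
    and \<psi> :: "('i \<Rightarrow>\<^sub>0 int) \<Rightarrow> 'g"
    and H :: "'g set"
    and \<aa> :: "(('i \<Rightarrow>\<^sub>0 nat) \<Rightarrow>\<^sub>0 'a::{comm_ring, comm_monoid_mult}) set"
    and M :: "(('i \<Rightarrow>\<^sub>0 nat) \<Rightarrow>\<^sub>0 'a, 'm, 'y) module_scheme"
    and N :: "'g \<Rightarrow> 'm set"
  assumes "comm_group G"
    and "\<psi> \<in> epi (free_Abelian_group I) G"
    and "subgroup H G"
    and "finite (rcosets\<^bsub>G\<^esub> H)"
    and "monomial_ideal I \<aa>"
    and "finite_type (poly_alg I) \<aa>"
    and "graded_module (G\<lparr>carrier := H\<rparr>) (deg_restr I \<psi> H) (homog I \<psi>) M N"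
  shows "torsion (deg_restr I \<psi> H) (restr_ideal I \<psi> H \<aa>) M =
         torsion (deg_restr I \<psi> H) (floor_restr_ideal I \<psi> H \<aa>) M \<and>
         torsion (deg_restr I \<psi> H) (floor_restr_ideal I \<psi> H \<aa>) M =
         torsion (deg_restr I \<psi> H) (restr_ideal I \<psi> H (floor_ideal I \<aa>)) M"
proof -
  have G: "group G" using assms(1) by (rule comm_group.axioms(2))
  have \<psi>: "\<psi> \<in> hom (free_Abelian_group I) G" using assms(2) by (simp add: epi_def)
  interpret group G by (rule G)
  interpret H: subgroup H G by (rule assms(3))
  define Q where "Q = {\<mu> \<in> exps I. mdeg \<psi> \<mu> \<in> H}"
  interpret R: exponent_monoid "exps I" by (rule exponent_monoid_exps)
  interpret S: exponent_monoid Q unfolding Q_def by (rule exponent_monoid_deg[OF G \<psi> assms(3)])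
  let ?S = "mon_ring Q :: (('i \<Rightarrow>\<^sub>0 nat) \<Rightarrow>\<^sub>0 'a) ring"
  interpret SR: cring ?S by (rule S.cring_mon_ring)
  have S: "deg_restr I \<psi> H = ?S" by (simp add: deg_restr_eq_mon_ring Q_def)
  define E where "E = min_exps I \<aa>"
  note E = min_exps_finite_type[OF assms(5,6), folded E_def]
  define pow where "pow m e = Poly_Mapping.map (\<lambda>_. m) e" for m :: nat and e :: "'i \<Rightarrow>\<^sub>0 nat"
  have supp_mono: "supp_mono m e = monomial (pow m e)" for m e
    by (simp add: supp_mono_def pow_def)
  have pow_exps: "pow m e \<in> exps I" if "e \<in> E" for m e
    using that E(2) map_const_exps[of e I] by (auto simp: pow_def)
  define mm where "mm e = (LEAST m. (supp_mono m e :: _ \<Rightarrow>\<^sub>0 'a) \<in> restr_ideal I \<psi> H \<aa>)" for e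
  have restr: "restr_ideal I \<psi> H (supported U) = (supported (U \<inter> Q) :: (_ \<Rightarrow>\<^sub>0 'a) set)" for U
    by (simp add: restr_ideal_def S supported_Int)
  have ideal_restr: "ideal (supported (upset (exps I) B \<inter> Q)) ?S" if "B \<subseteq> exps I" for B
  proof (rule S.ideal_supported)
    fix \<mu> \<nu> assume "\<mu> \<in> upset (exps I) B \<inter> Q" "\<nu> \<in> Q"
    then show "\<mu> + \<nu> \<in> upset (exps I) B \<inter> Q"
      using R.upset_add[of \<mu> B \<nu>] S.add_mem[of \<mu> \<nu>] unfolding Q_def by blast
  qed simp
  \<comment> \<open>\<open>LEAST\<close> is meaningful once some admissible \<open>m\<close> is
    exhibited. Since \<open>E\<close> is nonempty here, 1 \<noteq> 0, so the exponent can be read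
    off from membership of the monomial.\<close>
  have mm: "pow (mm e) e \<in> upset (exps I) E \<inter> Q" if e: "e \<in> E" for e
  proof -
    have e': "e \<in> exps I" "(1::'a) \<noteq> 0" using e E(2,4) by auto
    obtain m where m: "mdeg \<psi> (pow m e) \<in> H" "\<forall>i. Poly_Mapping.lookup e i \<le> Poly_Mapping.lookup (pow m e) i"
      using ex_map_const_degree[OF G \<psi> assms(3,4) e'(1)] unfolding pow_def by blast
    have "pow m e \<in> upset (exps I) E \<inter> Q"
      using m e pow_exps[OF e, of m] by (auto simp: Q_def mem_upset_exps_iff)
    then have "(supp_mono m e :: _ \<Rightarrow>\<^sub>0 'a) \<in> restr_ideal I \<psi> H \<aa>"
      by (subst E(3)) (simp add: restr supp_mono monomial_in_supported_iff)
    then have "(supp_mono (mm e) e :: _ \<Rightarrow>\<^sub>0 'a) \<in> restr_ideal I \<psi> H \<aa>"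
      unfolding mm_def by (rule LeastI)
    then show ?thesis
      by (subst (asm) E(3)) (use e'(2) in \<open>simp add: restr supp_mono monomial_in_supported_iff\<close>)
  qed
  define B where "B = (\<lambda>e. pow (mm e) e) ` E"
  define C where "C = pow 1 ` E"
  have B: "B \<subseteq> upset (exps I) E \<inter> Q" using mm by (auto simp: B_def)
  have C: "C \<subseteq> exps I" using pow_exps by (auto simp: C_def)
  \<comment> \<open>The three ideals of the statement, described by their exponents: the restriction
    of \<aa>, the ideal of \<open>S\<close> generated by the chosen powers, and the restriction of
    the floor of \<aa>.\<close>
  define \<aa>' where "\<aa>' = (supported (upset (exps I) E \<inter> Q) :: (_ \<Rightarrow>\<^sub>0 'a) set)"
  define \<bb> where "\<bb> = (supported (upset Q B) :: (_ \<Rightarrow>\<^sub>0 'a) set)"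
  define \<cc> where "\<cc> = (supported (upset (exps I) C \<inter> Q) :: (_ \<Rightarrow>\<^sub>0 'a) set)"
  have eqs: "restr_ideal I \<psi> H \<aa> = \<aa>'" "floor_restr_ideal I \<psi> H \<aa> = \<bb>"
    "restr_ideal I \<psi> H (floor_ideal I \<aa>) = \<cc>"
  proof -
    show "restr_ideal I \<psi> H \<aa> = \<aa>'" unfolding \<aa>'_def by (subst E(3)) (rule restr)
    have "floor_restr_ideal I \<psi> H \<aa> = Idl\<^bsub>?S\<^esub> (monomial ` B)"
      by (simp add: floor_restr_ideal_def S B_def image_image supp_mono mm_def E_def)
    then show "floor_restr_ideal I \<psi> H \<aa> = \<bb>"
      using S.genideal_monomials[of B] B by (simp add: \<bb>_def)
    have "floor_ideal I \<aa> = Idl\<^bsub>mon_ring (exps I)\<^esub> (monomial ` C)"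
      by (simp add: floor_ideal_def C_def image_image supp_mono E_def poly_alg_eq_mon_ring)
    also have "\<dots> = supported (upset (exps I) C)" by (rule R.genideal_monomials[OF C])
    finally show "restr_ideal I \<psi> H (floor_ideal I \<aa>) = \<cc>" by (simp add: \<cc>_def restr)
  qed
  have ideals: "ideal \<aa>' ?S" "ideal \<bb> ?S" "ideal \<cc> ?S"
    using ideal_restr[OF E(2)] ideal_restr[OF C] S.ideal_supported_upset[of B] B
    by (auto simp: \<aa>'_def \<bb>_def \<cc>_def)
  have "upset Q B \<subseteq> upset (exps I) E \<inter> Q"
  proof
    fix \<mu> assume "\<mu> \<in> upset Q B"
    then obtain b q where "\<mu> = b + q" "b \<in> B" "q \<in> Q" by (auto simp: upset_def)
    then show "\<mu> \<in> upset (exps I) E \<inter> Q"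
      using B R.upset_add[of b E q] S.add_mem[of b q] by (auto simp: Q_def)
  qed
  then have ba: "\<bb> \<subseteq> \<aa>'" unfolding \<aa>'_def \<bb>_def by (rule supported_mono)
  have "upset (exps I) E \<subseteq> upset (exps I) C"
  proof
    fix \<mu> assume \<mu>: "\<mu> \<in> upset (exps I) E"
    then have \<mu>': "\<mu> \<in> exps I" using R.upset_subset[OF E(2)] by blast
    then obtain e where e: "e \<in> E" "\<forall>i. Poly_Mapping.lookup e i \<le> Poly_Mapping.lookup \<mu> i"
      using \<mu> mem_upset_exps_iff by blast
    have "Poly_Mapping.lookup (pow 1 e) i \<le> Poly_Mapping.lookup \<mu> i" for i
      using e(2)[rule_format, of i] by (auto simp: pow_def lookup_map_const in_keys_iff)
    then show "\<mu> \<in> upset (exps I) C" using e(1) mem_upset_exps_iff[OF \<mu>', of C] by (auto simp: C_def)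
  qed
  then have ac: "\<aa>' \<subseteq> \<cc>" unfolding \<aa>'_def \<cc>_def by (intro supported_mono) blast
  \<comment> \<open>If \<open>t e < mm e\<close> held for all \<open>e\<close> in \<open>E\<close>,
    the sum of \<open>t\<close> could not reach \<open>k\<close>. The \<open>Suc\<close> matters for
    empty \<open>E\<close>, where the zeroth power would be the whole ring instead of the zero
    ideal.\<close>
  define k where "k = Suc (sum mm E)"
  have "\<cc> [^]\<^bsub>ideals_set ?S\<^esub> k \<subseteq> \<bb>"
  proof
    fix f assume f: "f \<in> \<cc> [^]\<^bsub>ideals_set ?S\<^esub> k"
    have "upset (exps I) C \<subseteq> {\<mu>. \<exists>e\<in>E. \<forall>i\<in>Poly_Mapping.keys e. 1 \<le> Poly_Mapping.lookup \<mu> i}"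
      by (fastforce simp: upset_def C_def pow_def lookup_add lookup_map_const)
    then have "\<cc> \<subseteq> supported {\<mu>. \<exists>e\<in>E. \<forall>i\<in>Poly_Mapping.keys e. 1 \<le> Poly_Mapping.lookup \<mu> i}"
      unfolding \<cc>_def by (intro supported_mono) blast
    from subsetD[OF pow_subset_supported[OF E(1) this] f] have
      f1: "\<exists>t. sum t E = k \<and> (\<forall>e\<in>E. \<forall>i\<in>Poly_Mapping.keys e. t e \<le> Poly_Mapping.lookup \<mu> i)"
      if "\<mu> \<in> Poly_Mapping.keys f" for \<mu>
      using that by (auto simp: supported_def)
    interpret J: comm_monoid "ideals_set ?S" by (rule SR.ideals_set_is_comm_monoid)
    have pow_ideal: "ideal (\<cc> [^]\<^bsub>ideals_set ?S\<^esub> k) ?S"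
      using J.nat_pow_closed[of \<cc> k] ideals(3) by (simp add: ideals_set_def)
    \<comment> \<open>The bound on powers says nothing about degrees; that all degrees lie in
      \<open>H\<close> comes from the power being an ideal of \<open>S\<close>.\<close>
    have f2: "f \<in> supported Q" using ideal.Icarr[OF pow_ideal f] by simp
    have "\<mu> \<in> upset Q B" if \<mu>: "\<mu> \<in> Poly_Mapping.keys f" for \<mu>
    proof -
      have \<mu>Q: "\<mu> \<in> Q" "\<mu> \<in> exps I" using f2 \<mu> by (auto simp: supported_def Q_def)
      obtain t where t: "sum t E = k" "\<forall>e\<in>E. \<forall>i\<in>Poly_Mapping.keys e. t e \<le> Poly_Mapping.lookup \<mu> i"
        using f1[OF \<mu>] by blast
      have "\<exists>e\<in>E. mm e \<le> t e"
      proof (rule ccontr)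
        assume "\<not> ?thesis"
        then have "sum t E \<le> sum mm E" by (intro sum_mono) (meson nat_le_linear)
        then show False using t(1) by (simp add: k_def)
      qed
      then obtain e where e: "e \<in> E" "mm e \<le> t e" by blast
      let ?b = "pow (mm e) e"
      have "\<forall>i. Poly_Mapping.lookup ?b i \<le> Poly_Mapping.lookup \<mu> i"
        using t(2) e by (auto simp: pow_def lookup_map_const intro: order_trans)
      then obtain q where q: "\<mu> = ?b + q" "q \<in> exps I"
        using mem_upset_exps_iff[OF \<mu>Q(2), of "{?b}"] by (auto simp: upset_def)
      have b: "?b \<in> exps I" "mdeg \<psi> ?b \<in> H" using mm[OF e(1)] by (auto simp: Q_def)
      have qG: "mdeg \<psi> q \<in> carrier G"
        using hom_in_carrier[OF \<psi>, of "Poly_Mapping.map int q"] q(2)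
        by (simp add: mdeg_def exps_def free_Abelian_group_def keys_map_int)
      \<comment> \<open>So far \<open>q\<close> is only a quotient in \<open>R\<close>. Both \<mu>
        and \<open>?b\<close> have degree in the subgroup \<open>H\<close>, so cancelling puts the
        degree of \<open>q\<close> in \<open>H\<close> as well, and the divisibility holds in
        \<open>S\<close>.\<close>
      have "mdeg \<psi> ?b \<otimes>\<^bsub>G\<^esub> mdeg \<psi> q \<in> H"
        using \<mu>Q(1) mdeg_add[OF \<psi> b(1) q(2)] by (simp add: Q_def q(1))
      then have "inv\<^bsub>G\<^esub> (mdeg \<psi> ?b) \<otimes>\<^bsub>G\<^esub> (mdeg \<psi> ?b \<otimes>\<^bsub>G\<^esub> mdeg \<psi> q) \<in> H"
        using b(2) by blast
      then have "mdeg \<psi> q \<in> H" using b(2) qG by (simp add: inv_solve_left' m_assoc[symmetric])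
      then show ?thesis using q e(1) by (auto simp: upset_def B_def Q_def)
    qed
    then show "f \<in> \<bb>" by (auto simp: \<bb>_def supported_def)
  qed
  \<comment> \<open>A power of \<cc> inside \<bb> closes the cycle: the inclusions of \<bb> in
    \<aa>' and of \<aa>' in \<cc> reverse on torsion.\<close>
  then have "torsion ?S \<bb> M \<subseteq> torsion ?S \<cc> M" by (rule SR.torsion_subset[OF ideals(3)])
  moreover have "torsion ?S \<aa>' M \<subseteq> torsion ?S \<bb> M" by (rule SR.torsion_antimono[OF ideals(2) ba])
  moreover have "torsion ?S \<cc> M \<subseteq> torsion ?S \<aa>' M" by (rule SR.torsion_antimono[OF ideals(1) ac])
  ultimately show ?thesis unfolding eqs S by blast
qed

end
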